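(* Let $N\in\mathbb{N}$, let $\gamma_n$ ($-N+1\le n\le N$) be real with $\gamma_n=-\gamma_{1-n}$, and let $J=H+iG$ be the $2N\times2N$ matrix with entries $H_{nm}=\delta_{n,m+1}+\delta_{n,m-1}$ and $G_{nm}=\gamma_n\delta_{n,m}$, $-N+1\le n,m\le N$. 1. If $\sum_{n=1}^N\gamma_n^2>2N-1$, then $J$ has at least two eigenvalues with nonzero imaginary part. 2. If $|\gamma_N|>1$ and $|\gamma_n|>2$ for each $n\in\{1,2,\ldots,N-1\}$, then $J$ has no purely real eigenvalues.
   Context: $\delta_{n,m}$ is the Kronecker symbol; rows and columns are indexed by integers from $-N+1$ to $N$. *)

theory Defs
  imports Complex_Main "Jordan_Normal_Form.Char_Poly"
begin

text \<open>
  Rows and columns of the matrices below are labelled by the integers from \<open>-N+1\<close> to \<open>N\<close>, whereas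
  the library's matrices are indexed from \<open>0\<close>: position \<open>i < 2 * N\<close> carries the label \<open>i - N + 1\<close>.
\<close>

definition label :: "nat \<Rightarrow> nat \<Rightarrow> int" where
  "label N i = int i - int N + 1"

definition labelled_mat :: "nat \<Rightarrow> (int \<Rightarrow> int \<Rightarrow> 'a) \<Rightarrow> 'a mat" where
  "labelled_mat N a = mat (2 * N) (2 * N) (\<lambda>(i, j). a (label N i) (label N j))"

lemma bij_betw_label: "bij_betw (label N) {..<2 * N} {- int N + 1..int N}"
  by (rule bij_betw_byWitness[where f' = "\<lambda>n. nat (n + int N - 1)"])
     (auto simp: label_def)

definition kronecker :: "int \<Rightarrow> int \<Rightarrow> complex" where
  "kronecker n m = (if n = m then 1 else 0)"

definition H_mat :: "nat \<Rightarrow> complex mat" where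
  "H_mat N = labelled_mat N (\<lambda>n m. kronecker n (m + 1) + kronecker n (m - 1))"

definition G_mat :: "nat \<Rightarrow> (int \<Rightarrow> real) \<Rightarrow> complex mat" where
  "G_mat N \<gamma> = labelled_mat N (\<lambda>n m. complex_of_real (\<gamma> n) * kronecker n m)"

definition J_mat :: "nat \<Rightarrow> (int \<Rightarrow> real) \<Rightarrow> complex mat" where
  "J_mat N \<gamma> = H_mat N + \<i> \<cdot>\<^sub>m G_mat N \<gamma>"

end

theory Submission
  imports Defs "Jordan_Normal_Form.Schur_Decomposition" "Jordan_Normal_Form.Spectral_Radius"
begin

text \<open>
  The sum of the squares of the eigenvalues of \<open>J\<close> is the trace of \<open>J\<^sup>2\<close>, that is,
  \<open>2 (2N - 1) - 2 (\<gamma>\<^sub>1\<^sup>2 + \<dots> + \<gamma>\<^sub>N\<^sup>2)\<close>; when this is negative, not all eigenvalues are real.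
  Reversing the order of rows and columns turns \<open>J\<close> into its complex conjugate, so the nonreal
  eigenvalues come in conjugate pairs. Under the hypotheses of the second part, \<open>J - x\<close> is strictly
  diagonally dominant for every real \<open>x\<close>, hence invertible.
\<close>

section \<open>Traces, similarity and squares of eigenvalues\<close>

definition trace :: "'a :: comm_ring_1 mat \<Rightarrow> 'a" where
  "trace A = (\<Sum>i<dim_row A. A $$ (i, i))"

lemma index_mult_mat_sum:
  assumes "A \<in> carrier_mat n m" "B \<in> carrier_mat m k" "i < n" "j < k"
  shows "(A * B) $$ (i, j) = (\<Sum>l<m. A $$ (i, l) * B $$ (l, j))"
  using assms by (auto simp: scalar_prod_def atLeast0LessThan)

lemma trace_mult_eq_sum:
  assumes "A \<in> carrier_mat n m" "B \<in> carrier_mat m n"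
  shows "trace (A * B) = (\<Sum>i<n. \<Sum>j<m. A $$ (i, j) * B $$ (j, i))"
  using assms by (auto simp: trace_def index_mult_mat_sum[OF assms] simp del: index_mult_mat(1))

lemma trace_mult_commute:
  assumes "A \<in> carrier_mat n m" "B \<in> carrier_mat m n"
  shows "trace (A * B) = trace (B * A)"
  unfolding trace_mult_eq_sum[OF assms] trace_mult_eq_sum[OF assms(2,1)]
  by (subst sum.swap) (simp add: mult.commute)

text \<open>In a factorization A = P B Q the trace lets the factor Q move to the front, where it
  cancels against P.\<close>

lemma trace_similar:
  assumes "similar_mat A B"
  shows "trace A = trace B"
proof -
  obtain P Q where wit: "similar_mat_wit A B P Q"
    using assms by (auto simp: similar_mat_def)
  note w = similar_mat_witD[OF refl wit]
  define n where "n = dim_row A"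
  note w = w[folded n_def]
  have "trace A = trace (Q * (P * B))"
    unfolding w(3) by (rule trace_mult_commute[of _ n n]) (use w in auto)
  also have "Q * (P * B) = (Q * P) * B"
    using assoc_mult_mat[OF w(7,6,5)] by simp
  finally show ?thesis
    using w by simp
qed

text \<open>For i different from j, one of the positions (i, j) and (j, i) lies below the diagonal,
  so the product of the two entries vanishes.\<close>

lemma trace_square_upper_triangular:
  assumes "B \<in> carrier_mat n n" "upper_triangular B"
  shows "trace (B * B) = (\<Sum>e\<leftarrow>diag_mat B. e\<^sup>2)"
proof -
  have "B $$ (i, j) * B $$ (j, i) = (if j = i then (B $$ (i, i))\<^sup>2 else 0)"
    if "i < n" "j < n" for i j
    using assms that by (cases i j rule: linorder_cases) (auto simp: power2_eq_square upper_triangular_def)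
  then have "trace (B * B) = (\<Sum>i<n. \<Sum>j<n. if j = i then (B $$ (i, i))\<^sup>2 else 0)"
    unfolding trace_mult_eq_sum[OF assms(1,1)] by (intro sum.cong) auto
  also have "\<dots> = (\<Sum>i<n. (B $$ (i, i))\<^sup>2)"
    by simp
  also have "\<dots> = (\<Sum>e\<leftarrow>diag_mat B. e\<^sup>2)"
    using assms(1)
    by (simp add: diag_mat_def comp_def interv_sum_list_conv_sum_set_nat atLeast0LessThan)
  finally show ?thesis .
qed

text \<open>By Schur triangularization the trace of the square is the sum of the squared eigenvalues
  with multiplicity, and squares of reals are nonnegative. The contrapositive yields a nonreal
  eigenvalue of J.\<close>

lemma trace_square_nonneg_if_real_eigenvalues:
  fixes A :: "complex mat"
  assumes A: "A \<in> carrier_mat n n" and real: "\<And>z. eigenvalue A z \<Longrightarrow> z \<in> \<real>"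
  shows "Re (trace (A * A)) \<ge> 0"
proof -
  obtain es where es: "char_poly A = (\<Prod>a\<leftarrow>es. [:- a, 1:])"
    using char_poly_factorized[OF A] by blast
  obtain B P Q where B: "similar_mat_wit A B P Q" "upper_triangular B" "diag_mat B = es"
    using schur_decomposition[OF A es] by (metis prod_cases3)
  have Bc: "B \<in> carrier_mat n n"
    using similar_mat_witD2[OF A B(1)] by simp
  \<comment> \<open>The square is written as a power because similarity passes to powers with the
    same P and Q.\<close>
  have "similar_mat_wit (A ^\<^sub>m 2) (B ^\<^sub>m 2) P Q"
    using B(1) by (rule similar_mat_wit_pow)
  then have "similar_mat (A * A) (B * B)"
    using A Bc by (auto simp: similar_mat_def numeral_2_eq_2)
  then have "trace (A * A) = (\<Sum>e\<leftarrow>es. e\<^sup>2)"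
    using trace_similar[of "A * A"] trace_square_upper_triangular[OF Bc B(2)] B(3) by simp
  \<comment> \<open>The entries of \<open>es\<close> are roots of the characteristic polynomial,
    hence eigenvalues.\<close>
  moreover have "e \<in> \<real>" if "e \<in> set es" for e
    by (rule real) (use that in \<open>auto simp: eigenvalue_root_char_poly[OF A] es poly_prod_list prod_list_zero_iff\<close>)
  then have "Re (\<Sum>e\<leftarrow>es. e\<^sup>2) \<ge> 0"
    by (induction es) (auto simp: complex_is_Real_iff)
  ultimately show ?thesis
    by simp
qed

section \<open>Eigenvalues in coordinates and diagonal dominance\<close>

lemma eigenvalue_iff_sum:
  assumes A: "A \<in> carrier_mat n n"
  shows "eigenvalue A k \<longleftrightarrow>
    (\<exists>f. (\<exists>i<n. f i \<noteq> 0) \<and> (\<forall>i<n. (\<Sum>j<n. A $$ (i, j) * f j) = k * f i))"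
proof
  assume "eigenvalue A k"
  then obtain v where v: "v \<in> carrier_vec n" "v \<noteq> 0\<^sub>v n" "A *\<^sub>v v = k \<cdot>\<^sub>v v"
    using A by (auto simp: eigenvalue_def eigenvector_def)
  have "\<exists>i<n. v $ i \<noteq> 0"
    using v(1,2) by (metis carrier_vecD eq_vecI index_zero_vec)
  moreover have "(\<Sum>j<n. A $$ (i, j) * v $ j) = k * v $ i" if "i < n" for i
    using arg_cong[OF v(3), of "\<lambda>w. w $ i"] that A v(1)
    by (simp add: scalar_prod_def atLeast0LessThan)
  ultimately show "\<exists>f. (\<exists>i<n. f i \<noteq> 0) \<and> (\<forall>i<n. (\<Sum>j<n. A $$ (i, j) * f j) = k * f i)"
    by blast
next
  assume "\<exists>f. (\<exists>i<n. f i \<noteq> 0) \<and> (\<forall>i<n. (\<Sum>j<n. A $$ (i, j) * f j) = k * f i)"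
  then obtain f i where f: "i < n" "f i \<noteq> 0"
    "\<And>i. i < n \<Longrightarrow> (\<Sum>j<n. A $$ (i, j) * f j) = k * f i"
    by blast
  have "vec n f \<noteq> 0\<^sub>v n"
    using f(1,2) by (metis index_vec index_zero_vec(1))
  moreover have "A *\<^sub>v vec n f = k \<cdot>\<^sub>v vec n f"
    by (rule eq_vecI) (use A f(3) in \<open>auto simp: scalar_prod_def atLeast0LessThan\<close>)
  ultimately show "eigenvalue A k"
    using A by (auto simp: eigenvalue_def eigenvector_def intro!: exI[of _ "vec n f"])
qed

text \<open>Compare moduli in a row where the eigenvector has its largest entry.\<close>

lemma not_eigenvalue_if_diagonally_dominant:
  fixes A :: "complex mat"
  assumes A: "A \<in> carrier_mat n n"
    and dom: "\<And>i. i < n \<Longrightarrow> (\<Sum>j\<in>{..<n} - {i}. cmod (A $$ (i, j))) < cmod (A $$ (i, i) - k)"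
  shows "\<not> eigenvalue A k"
proof
  assume "eigenvalue A k"
  then obtain f i0 where f: "i0 < n" "f i0 \<noteq> 0"
    "\<And>i. i < n \<Longrightarrow> (\<Sum>j<n. A $$ (i, j) * f j) = k * f i"
    unfolding eigenvalue_iff_sum[OF A] by blast
  have "\<exists>i\<in>{..<n}. \<forall>j\<in>{..<n}. cmod (f j) \<le> cmod (f i)"
    using finite_lessThan f(1)
      Max_in[of "(\<lambda>i. cmod (f i)) ` {..<n}"] Max_ge[of "(\<lambda>i. cmod (f i)) ` {..<n}"]
    by (smt (verit) empty_iff finite_imageI imageE imageI lessThan_iff)
  then obtain i where i: "i < n" "\<And>j. j < n \<Longrightarrow> cmod (f j) \<le> cmod (f i)"
    by auto
  have pos: "cmod (f i) > 0"
    using i(2)[OF f(1)] f(2) by (metis norm_le_zero_iff not_le order_trans)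
  have "(\<Sum>j<n. A $$ (i, j) * f j) = A $$ (i, i) * f i + (\<Sum>j\<in>{..<n} - {i}. A $$ (i, j) * f j)"
    using i(1) by (simp add: sum.remove)
  then have "(A $$ (i, i) - k) * f i = - (\<Sum>j\<in>{..<n} - {i}. A $$ (i, j) * f j)"
    using f(3)[OF i(1)] by (simp add: algebra_simps)
  then have "cmod (A $$ (i, i) - k) * cmod (f i) = cmod (\<Sum>j\<in>{..<n} - {i}. A $$ (i, j) * f j)"
    by (metis norm_minus_cancel norm_mult)
  \<comment> \<open>Here the choice of i enters: every entry of f is at most \<open>f i\<close> in
    modulus.\<close>
  also have "\<dots> \<le> (\<Sum>j\<in>{..<n} - {i}. cmod (A $$ (i, j)) * cmod (f i))"
    by (rule sum_norm_le) (auto simp: norm_mult intro!: mult_left_mono i(2))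
  also have "\<dots> < cmod (A $$ (i, i) - k) * cmod (f i)"
    using mult_strict_right_mono[OF dom[OF i(1)] pos] by (simp add: sum_distrib_right)
  finally show False
    by simp
qed

section \<open>Entries, row sums and trace of the square of J\<close>

lemma J_mat_carrier [simp]: "J_mat N \<gamma> \<in> carrier_mat (2 * N) (2 * N)"
  by (simp add: J_mat_def H_mat_def G_mat_def labelled_mat_def)

lemma J_mat_index:
  assumes "i < 2 * N" "j < 2 * N"
  shows "J_mat N \<gamma> $$ (i, j) =
    (if i = Suc j \<or> j = Suc i then 1 else if i = j then \<i> * of_real (\<gamma> (label N i)) else 0)"
  using assms
  by (auto simp: J_mat_def H_mat_def G_mat_def labelled_mat_def kronecker_def label_def)

text \<open>The first and last indices have one neighbour, all others two; this is the source of the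
  thresholds 1 and 2 on \<gamma>. Since N is at least 1, the first and last rows are
  distinct.\<close>

lemma J_mat_offdiag_row_sum:
  assumes "i < 2 * N" "N \<ge> 1"
  shows "(\<Sum>j\<in>{..<2 * N} - {i}. cmod (J_mat N \<gamma> $$ (i, j))) =
    (if i = 0 \<or> i = 2 * N - 1 then 1 else 2)"
proof -
  have "(\<Sum>j\<in>{..<2 * N} - {i}. cmod (J_mat N \<gamma> $$ (i, j))) =
      (\<Sum>j\<in>{..<2 * N} - {i}. if i = Suc j \<or> j = Suc i then 1 else 0)"
    by (rule sum.cong) (use assms in \<open>auto simp: J_mat_index\<close>)
  also have "\<dots> = real (card {j \<in> {..<2 * N} - {i}. i = Suc j \<or> j = Suc i})"
    by (simp flip: sum.inter_filter)
  also have "{j \<in> {..<2 * N} - {i}. i = Suc j \<or> j = Suc i} =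
      (if i = 0 then {1} else if i = 2 * N - 1 then {i - 1} else {i - 1, Suc i})"
    using assms by auto
  finally show ?thesis
    using assms by auto
qed

lemma sum_label: "(\<Sum>i<2 * N. g (label N i)) = (\<Sum>n = - int N + 1..int N. g n)"
  by (rule sum.reindex_bij_betw[OF bij_betw_label])

text \<open>The 2N - 1 pairs of neighbouring indices count once in each order. The diagonal entries
  are purely imaginary, so their squares enter with a minus sign.\<close>

lemma trace_J_mat_square:
  assumes "N \<ge> 1"
  shows "trace (J_mat N \<gamma> * J_mat N \<gamma>) =
    of_real (2 * (2 * real N - 1) - (\<Sum>n = - int N + 1..int N. (\<gamma> n)\<^sup>2))"
proof -
  \<comment> \<open>\<open>?d\<close> marks the subdiagonal, with the superdiagonal as its
    transpose. Every row except row 0 contains exactly one mark, which gives n - 1 in total.\<close>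
  let ?d = "\<lambda>i j :: nat. if i = Suc j then 1 else 0 :: real"
  have count: "(\<Sum>i<n. \<Sum>j<n. ?d i j) = real n - 1" if "n \<ge> 1" for n
  proof -
    have "(\<Sum>j<n. ?d i j) = (if i = 0 then 0 else 1)" if "i < n" for i
      using that by (cases i) auto
    then have "(\<Sum>i<n. \<Sum>j<n. ?d i j) = (\<Sum>i<n. if i = 0 then 0 else 1)"
      by (intro sum.cong) auto
    also have "\<dots> = (\<Sum>i<n. 1 - (if i = 0 then 1 else 0))"
      by (intro sum.cong) auto
    also have "\<dots> = real n - 1"
      using that by (simp add: sum_subtractf)
    finally show ?thesis .
  qed
  have entry: "J_mat N \<gamma> $$ (i, j) * J_mat N \<gamma> $$ (j, i) =
      of_real (?d i j + ?d j i - (if j = i then (\<gamma> (label N i))\<^sup>2 else 0))"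
    if "i < 2 * N" "j < 2 * N" for i j
    using that by (auto simp: J_mat_index power2_eq_square algebra_simps)
  have "trace (J_mat N \<gamma> * J_mat N \<gamma>) = of_real (\<Sum>i<2 * N. \<Sum>j<2 * N.
      ?d i j + ?d j i - (if j = i then (\<gamma> (label N i))\<^sup>2 else 0))"
    unfolding trace_mult_eq_sum[OF J_mat_carrier J_mat_carrier] of_real_sum
    by (intro sum.cong refl entry) auto
  also have "(\<Sum>i<2 * N. \<Sum>j<2 * N. ?d i j + ?d j i - (if j = i then (\<gamma> (label N i))\<^sup>2 else 0)) =
      (\<Sum>i<2 * N. \<Sum>j<2 * N. ?d i j) + (\<Sum>i<2 * N. \<Sum>j<2 * N. ?d j i)
      - (\<Sum>i<2 * N. (\<gamma> (label N i))\<^sup>2)"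
    by (simp only: sum.distrib sum_subtractf) simp
  also have "(\<Sum>i<2 * N. \<Sum>j<2 * N. ?d j i) = (\<Sum>i<2 * N. \<Sum>j<2 * N. ?d i j)"
    by (rule sum.swap)
  finally show ?thesis
    using assms count[of "2 * N"] sum_label[of "\<lambda>n. (\<gamma> n)\<^sup>2" N] by simp
qed

section \<open>The reflection n -> 1 - n of the labels\<close>

lemma sum_even_labels:
  fixes g :: "int \<Rightarrow> real"
  assumes "\<And>n. n \<in> {1..int N} \<Longrightarrow> g (1 - n) = g n"
  shows "(\<Sum>n = - int N + 1..int N. g n) = 2 * (\<Sum>n = 1..int N. g n)"
proof -
  have split: "{- int N + 1..int N} = {- int N + 1..0} \<union> {1..int N}"
    by auto
  have "(\<Sum>n = - int N + 1..0. g n) = (\<Sum>n = 1..int N. g n)"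
    by (rule sum.reindex_bij_witness[of _ "\<lambda>n. 1 - n" "\<lambda>n. 1 - n"])
       (use assms[of "1 - _"] in auto)
  then show ?thesis
    unfolding split by (subst sum.union_disjoint) auto
qed

text \<open>Reversing the index order reflects the labels, which preserves neighbours and negates
  \<gamma>. So if f is an eigenvector for z, then f reversed and conjugated is one for the conjugate
  of z.\<close>

lemma eigenvalue_J_mat_cnj:
  assumes anti: "\<forall>n\<in>{- int N + 1..int N}. \<gamma> n = - \<gamma> (1 - n)"
    and ev: "eigenvalue (J_mat N \<gamma>) z"
  shows "eigenvalue (J_mat N \<gamma>) (cnj z)"
proof -
  let ?r = "\<lambda>i. 2 * N - Suc i"
  \<comment> \<open>With R the reversal permutation matrix, this says that J R equals R times the
    entrywise conjugate of J.\<close>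
  have flip: "J_mat N \<gamma> $$ (i, ?r j) = cnj (J_mat N \<gamma> $$ (?r i, j))"
    if "i < 2 * N" "j < 2 * N" for i j
  proof -
    have "label N (?r i) = 1 - label N i" "label N i \<in> {- int N + 1..int N}"
      using that by (auto simp: label_def)
    then have \<gamma>: "\<gamma> (label N i) = - \<gamma> (label N (?r i))"
      using bspec[OF anti, of "label N i"] by simp
    have eqs: "i = Suc (?r j) \<or> ?r j = Suc i \<longleftrightarrow> ?r i = Suc j \<or> j = Suc (?r i)"
      "i = ?r j \<longleftrightarrow> ?r i = j"
      using that by auto
    have "?r i < 2 * N" "?r j < 2 * N"
      using that by auto
    then show ?thesis
      by (simp only: J_mat_index that eqs) (simp add: \<gamma>)
  qed
  obtain f i0 where f: "i0 < 2 * N" "f i0 \<noteq> 0"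
    "\<And>i. i < 2 * N \<Longrightarrow> (\<Sum>j<2 * N. J_mat N \<gamma> $$ (i, j) * f j) = z * f i"
    using ev unfolding eigenvalue_iff_sum[OF J_mat_carrier] by blast
  have "(\<Sum>j<2 * N. J_mat N \<gamma> $$ (i, j) * cnj (f (?r j))) = cnj z * cnj (f (?r i))"
    if "i < 2 * N" for i
  proof -
    have "(\<Sum>j<2 * N. J_mat N \<gamma> $$ (i, j) * cnj (f (?r j))) =
        (\<Sum>j<2 * N. J_mat N \<gamma> $$ (i, ?r j) * cnj (f (?r (?r j))))"
      by (rule sum.nat_diff_reindex[symmetric])
    also have "\<dots> = cnj (\<Sum>j<2 * N. J_mat N \<gamma> $$ (?r i, j) * f j)"
      unfolding cnj_sum by (rule sum.cong) (use that in \<open>auto simp: flip\<close>)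
    also have "\<dots> = cnj z * cnj (f (?r i))"
      using f(3)[of "?r i"] that by simp
    finally show ?thesis .
  qed
  moreover have "\<exists>i<2 * N. cnj (f (?r i)) \<noteq> 0"
    using f(1,2) by (intro exI[of _ "?r i0"]) auto
  ultimately show ?thesis
    unfolding eigenvalue_iff_sum[OF J_mat_carrier] by (intro exI[of _ "\<lambda>i. cnj (f (?r i))"]) simp
qed

theorem theorem2p2:
  fixes N :: nat and \<gamma> :: "int \<Rightarrow> real"
  assumes "N \<ge> 1"
    and "\<forall>n\<in>{- int N + 1..int N}. \<gamma> n = - \<gamma> (1 - n)"
  shows "((\<Sum>n = 1..int N. (\<gamma> n)\<^sup>2) > 2 * real N - 1 \<longrightarrow>
            card {z. eigenvalue (J_mat N \<gamma>) z \<and> Im z \<noteq> 0} \<ge> 2) \<and>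
         (\<bar>\<gamma> (int N)\<bar> > 1 \<and> (\<forall>n\<in>{1..int N - 1}. \<bar>\<gamma> n\<bar> > 2) \<longrightarrow>
            \<not> (\<exists>z. eigenvalue (J_mat N \<gamma>) z \<and> z \<in> \<real>))"
proof (intro conjI impI)
  let ?J = "J_mat N \<gamma>"
  let ?S = "{z. eigenvalue ?J z \<and> Im z \<noteq> 0}"
  assume large: "(\<Sum>n = 1..int N. (\<gamma> n)\<^sup>2) > 2 * real N - 1"
  have "(\<Sum>n = - int N + 1..int N. (\<gamma> n)\<^sup>2) = 2 * (\<Sum>n = 1..int N. (\<gamma> n)\<^sup>2)"
    proof (rule sum_even_labels)
    fix n assume "n \<in> {1..int N}"
    then show "(\<gamma> (1 - n))\<^sup>2 = (\<gamma> n)\<^sup>2"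
      using bspec[OF assms(2), of n] by simp
  qed
  then have "Re (trace (?J * ?J)) < 0"
    using large by (simp add: trace_J_mat_square[OF assms(1)])
  then obtain z where z: "eigenvalue ?J z" "z \<notin> \<real>"
    using trace_square_nonneg_if_real_eigenvalues[OF J_mat_carrier, of N \<gamma>] by fastforce
  then have "{z, cnj z} \<subseteq> ?S" "z \<noteq> cnj z"
    using eigenvalue_J_mat_cnj[OF assms(2)] by (auto simp: complex_is_Real_iff complex_eq_iff)
  \<comment> \<open>Infinite sets have \<open>card\<close> 0, so finiteness is needed before a
    two-element subset bounds the cardinality from below.\<close>
  moreover have "finite ?S"
    by (rule finite_subset[OF _ card_finite_spectrum(1)[OF J_mat_carrier[of N \<gamma>]]])
       (auto simp: spectrum_def)
  ultimately show "card ?S \<ge> 2"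
    using card_mono[of ?S "{z, cnj z}"] by simp
next
  assume large: "\<bar>\<gamma> (int N)\<bar> > 1 \<and> (\<forall>n\<in>{1..int N - 1}. \<bar>\<gamma> n\<bar> > 2)"
  show "\<not> (\<exists>z. eigenvalue (J_mat N \<gamma>) z \<and> z \<in> \<real>)"
  proof clarify
    fix x assume "eigenvalue (J_mat N \<gamma>) x" "x \<in> \<real>"
    moreover have "(\<Sum>j\<in>{..<2 * N} - {i}. cmod (J_mat N \<gamma> $$ (i, j))) < cmod (J_mat N \<gamma> $$ (i, i) - x)"
      if i: "i < 2 * N" for i
    proof -
      define n where "n = label N i"
      \<comment> \<open>Of the labels n and 1 - n, m is the positive one, where the bounds on
        \<gamma> are assumed. The first and last rows, labelled -N + 1 and N, both give m =
        N.\<close>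
      define m where "m = (if n \<ge> 1 then n else 1 - n)"
      have n: "n \<in> {- int N + 1..int N}" "i = 0 \<or> i = 2 * N - 1 \<longleftrightarrow> m = int N"
        using i assms(1) by (auto simp: n_def m_def label_def)
      have "\<bar>\<gamma> n\<bar> = \<bar>\<gamma> m\<bar>"
        using bspec[OF assms(2) n(1)] by (simp add: m_def)
      moreover have "m \<in> {1..int N}"
        using n(1) by (auto simp: m_def)
      ultimately have "(if i = 0 \<or> i = 2 * N - 1 then 1 else 2) < \<bar>\<gamma> n\<bar>"
        using large n(2) by auto
      \<comment> \<open>Subtracting the real x leaves the imaginary part of the diagonal entry
        unchanged, so the bound is uniform in x.\<close>
      also have "\<bar>\<gamma> n\<bar> = \<bar>Im (J_mat N \<gamma> $$ (i, i) - x)\<bar>"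
        using i \<open>x \<in> \<real>\<close> by (simp add: J_mat_index n_def complex_is_Real_iff)
      also have "\<dots> \<le> cmod (J_mat N \<gamma> $$ (i, i) - x)"
        by (rule abs_Im_le_cmod)
      finally show ?thesis
        by (simp only: J_mat_offdiag_row_sum[OF i assms(1)])
    qed
    ultimately show False
      using not_eigenvalue_if_diagonally_dominant[OF J_mat_carrier] by blast
  qed
qed

end
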